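(* Let $x$ be an odd integer with $x>1$ and let $y$ be an integer with $y>2x-2$. Let $a,b,c\ge0$ be integers with $a\ge 4x-3$ and $b\ge y-2x+2$. Then the multiset $\{1^a,x^b,y^c\}$ has a linear realization.
   Context: For a positive integer $v$, $K_v$ is the complete graph on vertex set $\{0,\dots,v-1\}$ and the linear length of an edge $\{u,w\}$ is $|u-w|$. A multiset of positive integers of size $v-1$ has a linear realization if some Hamiltonian path in $K_v$ has multiset of linear edge lengths equal to it. $\{x_1^{a_1},\dots\}$ denotes the multiset with $x_i$ of multiplicity $a_i$. *)

theory Defs
  imports "Graph_Theory.Graph_Theory" "HOL-Library.Multiset"
begin

(* Undirected graphs are represented as symmetric digraphs, the convention of Graph_Theory. *)
definition complete_graph :: "nat \<Rightarrow> nat pair_pre_digraph" where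
  "complete_graph v =
     \<lparr> pverts = {0..<v}, parcs = {(u, w). u \<in> {0..<v} \<and> w \<in> {0..<v} \<and> u \<noteq> w} \<rparr>"

lemma complete_digraph_complete_graph: "complete_digraph v (with_proj (complete_graph v))"
  by (auto simp: complete_digraph_pair_def complete_graph_def)

definition hamiltonian_path :: "'a vwalk \<Rightarrow> ('a, 'b) pre_digraph \<Rightarrow> bool" where
  "hamiltonian_path p G \<longleftrightarrow> vpath p G \<and> set p = verts G"

definition linear_length :: "nat \<times> nat \<Rightarrow> nat" where
  "linear_length e = nat \<bar>int (fst e) - int (snd e)\<bar>"

(* vwalk_arcs p lists each edge of the path p once, oriented in the direction of traversal;
   linear_length does not depend on the orientation. *)
definition linear_edge_lengths :: "nat vwalk \<Rightarrow> nat multiset" where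
  "linear_edge_lengths p = image_mset linear_length (mset (vwalk_arcs p))"

(* A multiset of size v - 1 is realized in the complete graph on v vertices, so v = size M + 1.
   Edges of a complete graph have positive length, so only multisets of positive integers
   satisfy this predicate. *)
definition has_linear_realization :: "nat multiset \<Rightarrow> bool" where
  "has_linear_realization M \<longleftrightarrow>
     (\<exists>p. hamiltonian_path p (with_proj (complete_graph (size M + 1))) \<and>
          linear_edge_lengths p = M)"

end

theory Submission
  imports Defs
begin

text \<open>
  Call a realization standard if it starts at 0, and perfect if moreover it ends at the largest
  vertex; a perfect realization can be prolonged by a standard one. Modulo d, the interval
  {0, ..., q d + r - 1} splits into d columns, of height q + 1 for the residues below r and of
  height q for the others. A path on the residues lifts to a path that climbs and descends the
  columns alternately, at the cost of one edge of length d per step inside a column. Steps at the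
  bottom lift with their own length; steps at the top do so only between columns of equal height,
  except that the top of column d - 1 is followed by the top of column 0. The parities of r and d
  therefore decide how the residues must be ordered, and in the worst case (r odd, d odd) the last
  two columns are rerouted, trading an edge of length d for a short one.

  For d = x and residues in their natural order this yields realizations of all multisets
  consisting of at least x ones and copies of x. For d = y the residues are ordered by paths with
  steps 1 and x, built from the case d = x, that use between 2x - 2 and 3x - 4 ones (or only
  ones). The at least x ones and the copies of x that are then left over form a second standard
  realization, which is reflected and put in front.
\<close>

subsection \<open>Edge lengths of lists\<close>

lemma linear_length_nat: "linear_length (u, w) = (u - w) + (w - u)"
  by (auto simp: linear_length_def)

lemma linear_edge_lengths_simps [simp]:
  "linear_edge_lengths [] = {#}"
  "linear_edge_lengths [u] = {#}"
  "linear_edge_lengths (u # w # p) = add_mset (linear_length (u, w)) (linear_edge_lengths (w # p))"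
  by (simp_all add: linear_edge_lengths_def)

lemma size_linear_edge_lengths: "size (linear_edge_lengths p) = length p - 1"
  by (induction p rule: induct_list012) auto

lemma linear_edge_lengths_append:
  "p \<noteq> [] \<Longrightarrow> linear_edge_lengths (p @ q) = linear_edge_lengths p + linear_edge_lengths (last p # q)"
  by (induction p rule: induct_list012) auto

lemma linear_edge_lengths_append2:
  assumes "p \<noteq> []" "q \<noteq> []"
  shows "linear_edge_lengths (p @ q) =
    add_mset (linear_length (last p, hd q)) (linear_edge_lengths p + linear_edge_lengths q)"
  using assms by (cases q) (auto simp: linear_edge_lengths_append)

lemma linear_edge_lengths_rev: "linear_edge_lengths (rev p) = linear_edge_lengths p"
proof (induction p rule: induct_list012)
  case (3 u w p)
  have "linear_edge_lengths (rev (u # w # p)) = linear_edge_lengths (rev (w # p) @ [u])"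
    by simp
  also have "\<dots> = add_mset (linear_length (w, u)) (linear_edge_lengths (rev (w # p)))"
    by (subst linear_edge_lengths_append) auto
  finally show ?case
    using 3 by (simp add: linear_length_nat)
qed auto

lemma linear_edge_lengths_map:
  assumes "\<And>u w. u \<in> set p \<Longrightarrow> w \<in> set p \<Longrightarrow> linear_length (f u, f w) = linear_length (u, w)"
  shows "linear_edge_lengths (map f p) = linear_edge_lengths p"
  using assms by (induction p rule: induct_list012) auto

lemma linear_edge_lengths_shift: "linear_edge_lengths (map ((+) n) p) = linear_edge_lengths p"
  by (rule linear_edge_lengths_map) (simp add: linear_length_nat)

lemma linear_edge_lengths_reflect:
  "set p \<subseteq> {..n} \<Longrightarrow> linear_edge_lengths (map ((-) n) p) = linear_edge_lengths p"
  by (rule linear_edge_lengths_map)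
    (auto simp: linear_length_def of_nat_diff abs_minus_commute subset_eq)

text \<open>The vertex shared by the two paths is kept once, as the head of
  \<open>q\<close>.\<close>

lemma linear_edge_lengths_join:
  assumes "p \<noteq> []" "q \<noteq> []" "last p = hd q"
  shows "linear_edge_lengths (butlast p @ q) = linear_edge_lengths p + linear_edge_lengths q"
proof -
  obtain z q' where q: "q = z # q'"
    using assms by (cases q) auto
  have "butlast p @ q = p @ q'"
    using assms q append_butlast_last_id[of p] by (metis append.assoc append_Cons append_Nil list.sel(1))
  then have "linear_edge_lengths (butlast p @ q) = linear_edge_lengths p + linear_edge_lengths (last p # q')"
    by (simp only: linear_edge_lengths_append[OF assms(1)])
  then show ?thesis
    using assms(3) unfolding q by simp
qed

lemma replicate_mset_add: "replicate_mset (m + n) z = replicate_mset m z + replicate_mset n z"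
  by (induction m) auto

subsection \<open>Standard and perfect realizations\<close>

text \<open>Distinctness is encoded by counting: a path with \<open>size M\<close> edges has
  \<open>size M + 1\<close> entries, and these can cover \<open>{..size M}\<close> only if they are
  pairwise different.\<close>

definition realizes :: "nat list \<Rightarrow> nat multiset \<Rightarrow> bool" where
  "realizes p M \<longleftrightarrow> set p = {..size M} \<and> linear_edge_lengths p = M"

definition has_standard :: "nat multiset \<Rightarrow> bool" where
  "has_standard M \<longleftrightarrow> (\<exists>p. realizes p M \<and> hd p = 0)"

definition has_perfect :: "nat multiset \<Rightarrow> bool" where
  "has_perfect M \<longleftrightarrow> (\<exists>p. realizes p M \<and> hd p = 0 \<and> last p = size M)"

lemma realizes_nonempty: "realizes p M \<Longrightarrow> p \<noteq> []"
  by (auto simp: realizes_def)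

lemma realizes_length: "realizes p M \<Longrightarrow> length p = Suc (size M)"
  using size_linear_edge_lengths[of p] realizes_nonempty[of p M]
  by (cases p) (auto simp: realizes_def)

lemma realizes_distinct: "realizes p M \<Longrightarrow> distinct p"
  by (rule card_distinct) (simp add: realizes_length, simp add: realizes_def)

lemma realizes_imp_has_linear_realization:
  assumes "realizes p M"
  shows "has_linear_realization M"
proof -
  let ?G = "with_proj (complete_graph (size M + 1))"
  have dist: "distinct p" and ne: "p \<noteq> []" and set: "set p = {..size M}"
    using assms realizes_distinct realizes_nonempty by (auto simp: realizes_def)
  have arcs: "distinct q \<Longrightarrow> (u, w) \<in> set (vwalk_arcs q) \<Longrightarrow> u \<in> set q \<and> w \<in> set q \<and> u \<noteq> w"
    for u w :: nat and q
    by (induction q rule: induct_list012) auto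
  have arcs': "u \<le> size M \<and> w \<le> size M \<and> u \<noteq> w" if "(u, w) \<in> set (vwalk_arcs p)" for u w
    using arcs[OF dist that] set by auto
  have verts: "verts ?G = {..size M}"
    by (auto simp: complete_graph_def)
  have "vwalk p ?G"
    using ne set unfolding vwalk_def
    by (auto simp: complete_graph_def arcs_ends_def arc_to_ends_def image_iff less_Suc_eq_le
        dest: arcs')
  then have "hamiltonian_path p ?G"
    using dist set verts by (simp add: hamiltonian_path_def vpath_def)
  then show ?thesis
    using assms by (auto simp: has_linear_realization_def realizes_def)
qed

text \<open>The paths share the vertex \<open>size M\<close>: \<open>p\<close> stops just before it
  and the shifted \<open>q\<close> starts there. The heads, the ends and the vertices of the first
  part are recorded so that joins can be iterated and later cut again.\<close>

lemma realizes_join: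
  assumes p: "realizes p M" "last p = size M" and q: "realizes q N" "hd q = 0"
  defines "s \<equiv> butlast p @ map ((+) (size M)) q"
  shows "realizes s (M + N)" "hd s = hd p" "last s = size M + last q" "set (butlast p) = {..<size M}"
proof -
  have ne: "p \<noteq> []" "q \<noteq> []"
    using p q realizes_nonempty by auto
  define p' where "p' = butlast p"
  have p': "p = p' @ [size M]"
    using append_butlast_last_id[OF ne(1)] p(2) by (simp add: p'_def)
  have sp: "set p = {..size M}" "linear_edge_lengths p = M"
    and sq: "set q = {..size N}" "linear_edge_lengths q = N"
    using p(1) q(1) by (simp_all add: realizes_def)
  have "distinct (p' @ [size M])" "set (p' @ [size M]) = {..size M}"
    using realizes_distinct[OF p(1)] sp(1) by (simp_all only: p'[symmetric])
  then have "size M \<notin> set p'" "insert (size M) (set p') = {..size M}"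
    by simp_all
  then have b: "set p' = {..<size M}"
    by (metis Diff_insert_absorb lessThan_Suc_atMost lessThan_Suc lessThan_iff less_irrefl_nat)
  then show "set (butlast p) = {..<size M}"
    by (simp add: p'_def)
  have "{..<m} \<union> (+) m ` {..n} = {..m + n}" for m n :: nat
  proof (intro equalityI subsetI)
    fix z assume "z \<in> {..m + n}"
    then show "z \<in> {..<m} \<union> (+) m ` {..n}"
      by (cases "z < m") (simp_all add: image_iff bexI[of _ "z - m"])
  qed auto
  then have "set s = {..size (M + N)}"
    using b sq by (simp add: s_def p'_def)
  moreover have "hd (map ((+) (size M)) q) = size M"
    using ne q(2) by (simp add: hd_map)
  then have "linear_edge_lengths s = M + N"
    unfolding s_def using linear_edge_lengths_join[OF ne(1), of "map ((+) (size M)) q"] ne p(2) sp sq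
    by (simp add: linear_edge_lengths_shift)
  ultimately show "realizes s (M + N)"
    by (simp add: realizes_def)
  show "last s = size M + last q"
    using ne by (simp add: s_def last_map)
  show "hd s = hd p"
  \<comment> \<open>If \<open>p\<close> is a single vertex, \<open>butlast p\<close> is empty and
    the head comes from the shifted \<open>q\<close>; then \<open>M\<close> is empty and the shift
    is 0.\<close>
  proof (cases p')
    case Nil
    then show ?thesis
      using ne q(2) p' by (simp add: s_def hd_map)
  next
    case (Cons z r)
    then show ?thesis
      using p' by (simp add: s_def)
  qed
qed

lemma has_standard_add: "has_perfect M \<Longrightarrow> has_standard N \<Longrightarrow> has_standard (M + N)"
  unfolding has_standard_def has_perfect_def
  by (elim exE conjE, rule exI, intro conjI, erule (3) realizes_join(1), subst realizes_join(2))

lemma has_perfect_add: "has_perfect M \<Longrightarrow> has_perfect N \<Longrightarrow> has_perfect (M + N)"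
  unfolding has_perfect_def
  by (elim exE conjE, rule exI, intro conjI, erule (3) realizes_join(1))
    (simp_all add: realizes_join(2,3))

lemma has_perfect_imp_has_standard: "has_perfect M \<Longrightarrow> has_standard M"
  by (auto simp: has_standard_def has_perfect_def)

lemma linear_edge_lengths_interval:
  "linear_edge_lengths (map (\<lambda>k. c + k * d) [0..<h]) = replicate_mset (h - 1) d"
proof (induction h)
  case (Suc h)
  show ?case
  proof (cases h)
    case (Suc k)
    have "linear_edge_lengths (map (\<lambda>k. c + k * d) [0..<Suc h]) =
      add_mset (linear_length (c + k * d, c + h * d)) (replicate_mset (h - 1) d)"
      unfolding upt_Suc_append[OF le0] map_append using Suc.IH Suc
      by (subst linear_edge_lengths_append2) auto
    then show ?thesis
      using Suc by (simp add: linear_length_nat)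
  qed simp
qed simp

lemma has_perfect_ones: "has_perfect (replicate_mset n 1)"
  unfolding has_perfect_def realizes_def
  using linear_edge_lengths_interval[of 0 1 "Suc n"]
  by (intro exI[of _ "[0..<Suc n]"]) (auto simp: hd_append simp del: upt_Suc)

text \<open>Reflecting and reversing the first path makes it end at its largest vertex, where the
  second one takes over. The resulting path need not start at 0.\<close>

lemma has_standard_add_realizes:
  assumes "has_standard M" "has_standard N"
  shows "\<exists>p. realizes p (M + N)"
proof -
  obtain p q where p: "realizes p M" "hd p = 0" and q: "realizes q N" "hd q = 0"
    using assms by (auto simp: has_standard_def)
  let ?p = "rev (map ((-) (size M)) p)"
  have "(-) (size M) ` {..size M} = {..size M}"
  proof (intro equalityI subsetI)
    fix z assume "z \<in> {..size M}"
    then show "z \<in> (-) (size M) ` {..size M}"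
      by (intro image_eqI[of _ _ "size M - z"]) auto
  qed auto
  then have "realizes ?p M"
    using p by (auto simp: realizes_def linear_edge_lengths_rev linear_edge_lengths_reflect)
  moreover have "last ?p = size M"
    using p realizes_nonempty[OF p(1)] by (simp add: last_rev hd_map)
  ultimately have "realizes (butlast ?p @ map ((+) (size M)) q) (M + N)"
    using q by (rule realizes_join(1))
  then show ?thesis ..
qed

subsection \<open>Snakes through residue classes\<close>

text \<open>Column \<open>c\<close> is the residue class of \<open>c\<close> modulo
  \<open>d\<close>, with \<open>h c\<close> vertices. The flag \<open>up\<close> says whether the
  first column is climbed; the direction then alternates.\<close>

primrec snake :: "nat \<Rightarrow> (nat \<Rightarrow> nat) \<Rightarrow> bool \<Rightarrow> nat list \<Rightarrow> nat list" where
  "snake d h up [] = []"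
| "snake d h up (c # p) =
    (if up then map (\<lambda>k. c + k * d) [0..<h c] else rev (map (\<lambda>k. c + k * d) [0..<h c]))
    @ snake d h (\<not> up) p"

lemma snake_append:
  "snake d h up (p @ q) = snake d h up p @ snake d h (if even (length p) then up else \<not> up) q"
  by (induction p arbitrary: up) auto

lemma set_snake: "set (snake d h up p) = (\<Union>c\<in>set p. (\<lambda>k. c + k * d) ` {..<h c})"
  by (induction p arbitrary: up) (auto simp: atLeast0LessThan)

lemma snake_eq_Nil: "h (hd p) > 0 \<Longrightarrow> snake d h up p = [] \<longleftrightarrow> p = []"
  by (cases p) auto

lemma hd_snake:
  "p \<noteq> [] \<Longrightarrow> h (hd p) > 0 \<Longrightarrow>
    hd (snake d h up p) = (if up then hd p else hd p + (h (hd p) - 1) * d)"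
  by (cases p) (auto simp: hd_append hd_map hd_rev last_map)

lemma last_snake:
  assumes "p \<noteq> []" "h (last p) > 0"
  shows "last (snake d h up p) =
    (if up = even (length p) then last p else last p + (h (last p) - 1) * d)"
proof -
  have "last (snake d h up (butlast p @ [last p])) =
    (if up = even (length p) then last p else last p + (h (last p) - 1) * d)"
    using assms unfolding snake_append
    by (cases p rule: rev_cases) (auto simp: last_rev hd_map last_map)
  then show ?thesis
    using assms by simp
qed

text \<open>In columns of equal height \<open>k\<close> every crossing is horizontal, at the bottom
  or at the top, and so keeps the length it has between the residues. Each column contributes
  \<open>k - 1\<close> edges of length \<open>d\<close>.\<close>

lemma linear_edge_lengths_snake:
  assumes "p \<noteq> []" "k > 0" "\<And>c. c \<in> set p \<Longrightarrow> h c = k"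
  shows "linear_edge_lengths (snake d h up p) =
    linear_edge_lengths p + replicate_mset ((k - 1) * length p) d"
  using assms
proof (induction p arbitrary: up rule: induct_list012)
  case (2 c)
  then show ?case
    by (simp add: linear_edge_lengths_interval linear_edge_lengths_rev)
next
  case (3 c c' p)
  let ?C = "if up then map (\<lambda>k. c + k * d) [0..<k] else rev (map (\<lambda>k. c + k * d) [0..<k])"
  let ?R = "snake d h (\<not> up) (c' # p)"
  have hc: "h c = k" "h c' = k"
    using 3 by auto
  have ne: "?C \<noteq> []" "?R \<noteq> []"
    using 3 hc by auto
  have R: "linear_edge_lengths ?R =
      linear_edge_lengths (c' # p) + replicate_mset ((k - 1) * length (c' # p)) d"
    using 3 by (intro "3.IH") auto
  have C: "linear_edge_lengths ?C = replicate_mset (k - 1) d"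
    by (simp add: linear_edge_lengths_interval linear_edge_lengths_rev)
  have "hd ?R = (if up then c' + (k - 1) * d else c')"
    using hd_snake[of "c' # p" h d "\<not> up"] hc 3(4) by simp
  moreover have "last ?C = (if up then c + (k - 1) * d else c)"
    using 3(4) by (simp add: last_map last_rev hd_map)
  ultimately have link: "linear_length (last ?C, hd ?R) = linear_length (c, c')"
    by (auto simp: linear_length_nat)
  have "snake d h up (c # c' # p) = ?C @ ?R"
    using hc by simp
  then have L: "linear_edge_lengths (snake d h up (c # c' # p)) =
      add_mset (linear_length (c, c')) (linear_edge_lengths ?C + linear_edge_lengths ?R)"
    using linear_edge_lengths_append2[OF ne] link by (simp only:)
  have len: "(k - 1) * length (c # c' # p) = (k - 1) + (k - 1) * length (c' # p)"
    by simp
  show ?case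
    unfolding L R C len replicate_mset_add linear_edge_lengths_simps by (simp only: union_mset_add_mset_left union_mset_add_mset_right ac_simps)
qed auto

section \<open>Division of an interval into residue classes\<close>

lemma residue_classes_cover:
  fixes q r d :: nat
  assumes "r \<le> d" "d > 0"
  shows "(\<Union>c\<in>{..<d}. (\<lambda>k. c + k * d) ` {..<if c < r then Suc q else q}) = {..<q * d + r}"
    (is "?L = ?R")
proof (intro equalityI subsetI)
  fix z assume "z \<in> ?L"
  then obtain c k where c: "c < d" and k: "k < (if c < r then Suc q else q)" and z: "z = c + k * d"
    by auto
  show "z \<in> ?R"
  proof (cases "c < r")
    case True
    then have "k * d \<le> q * d" using k by (intro mult_le_mono1) auto
    then show ?thesis using z True by (simp only: lessThan_iff)
  next
    case False
    then have "Suc k * d \<le> q * d" using k by (intro mult_le_mono1) auto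
    then show ?thesis using z c by simp
  qed
next
  fix z assume z: "z \<in> ?R"
  have zd: "z = z mod d + z div d * d"
    by (rule mod_div_mult_eq[symmetric])
  have "z div d < (if z mod d < r then Suc q else q)"
  proof (rule ccontr)
    assume "\<not> ?thesis"
    then have n: "z div d \<ge> (if z mod d < r then Suc q else q)"
      by simp
    show False
    proof (cases "z mod d < r")
      case True
      then have "Suc q * d \<le> z div d * d" using n by (intro mult_le_mono1) auto
      then show ?thesis using z zd assms by (simp only: mult_Suc lessThan_iff)
    next
      case False
      then have "q * d \<le> z div d * d" using n by (intro mult_le_mono1) auto
      then show ?thesis using z zd False by (simp only: lessThan_iff)
    qed
  qed
  then have "z \<in> (\<lambda>k. z mod d + k * d) ` {..<if z mod d < r then Suc q else q}"
    using imageI[of "z div d" _ "\<lambda>k. z mod d + k * d"] by (simp only: lessThan_iff mod_div_mult_eq)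
  moreover have "z mod d \<in> {..<d}"
    using assms by simp
  ultimately show "z \<in> ?L"
    by (rule UN_I[rotated])
qed

text \<open>Since r is even, the step from the tall columns to the short ones is at the bottom.\<close>

lemma lift_even:
  fixes d q r :: nat and p1 p2 :: "nat list"
  defines "h \<equiv> \<lambda>c. if c < r then Suc q else q"
  defines "P \<equiv> snake d h True (p1 @ p2)"
  assumes p1: "set p1 = {..<r}" "length p1 = r" and p2: "set p2 = {r..<d}" "length p2 = d - r"
    and r: "r < d" "even r" and q: "q > 0"
  shows "set P = {..<q * d + r}" "hd P = hd (p1 @ p2)"
    and "linear_edge_lengths P =
      linear_edge_lengths (p1 @ p2) + replicate_mset ((q - 1) * d + r) d"
    and "odd d \<Longrightarrow> last P = last p2 + (q - 1) * d"
proof -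
  have h1: "h c = Suc q" if "c \<in> set p1" for c
    using that p1 by (simp add: h_def)
  have h2: "h c = q" if "c \<in> set p2" for c
    using that p2 by (simp add: h_def)
  have ne2: "p2 \<noteq> []"
    using p2 r by auto
  have "set (p1 @ p2) = {..<d}"
    using p1 p2 r by auto
  then show "set P = {..<q * d + r}"
    unfolding P_def set_snake using residue_classes_cover[of r d q] r by (simp add: h_def)
  have hpos: "h c > 0" for c
    using q by (simp add: h_def)
  show "hd P = hd (p1 @ p2)"
    unfolding P_def using ne2 hpos by (subst hd_snake) auto
  have P: "P = snake d h True p1 @ snake d h True p2"
    using r p1 by (simp add: P_def snake_append)
  have E2: "linear_edge_lengths (snake d h True p2) =
      linear_edge_lengths p2 + replicate_mset ((q - 1) * (d - r)) d"
    using linear_edge_lengths_snake[of p2 q h d True] ne2 q h2 p2 by simp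
  show "linear_edge_lengths P =
      linear_edge_lengths (p1 @ p2) + replicate_mset ((q - 1) * d + r) d"
  proof (cases "p1 = []")
    case True
    then show ?thesis
      using E2 p1 by (simp add: P)
  next
    case False
    have E1: "linear_edge_lengths (snake d h True p1) =
        linear_edge_lengths p1 + replicate_mset (q * r) d"
      using linear_edge_lengths_snake[of p1 "Suc q" h d True] False h1 p1 by simp
    have l: "last (snake d h True p1) = last p1"
      using last_snake[of p1 h d True] False hpos p1 r by simp
    have f: "hd (snake d h True p2) = hd p2"
      using hd_snake[of p2 h d True] ne2 hpos by simp
    have ne: "snake d h True p1 \<noteq> []" "snake d h True p2 \<noteq> []"
      using False ne2 hpos by (simp_all add: snake_eq_Nil)
    obtain q' e where "q = Suc q'" "d = r + e"
      using q r by (metis gr0_implies_Suc less_imp_add_positive)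
    then have n: "(q - 1) * d + r = q * r + (q - 1) * (d - r)"
      by (simp add: algebra_simps)
    show ?thesis
      unfolding P linear_edge_lengths_append2[OF ne] linear_edge_lengths_append2[OF False ne2]
        l f E1 E2 n replicate_mset_add
      by (simp only: union_mset_add_mset_left union_mset_add_mset_right ac_simps)
  qed
  show "last P = last p2 + (q - 1) * d" if "odd d"
  proof -
    have "last P = last (snake d h True p2)"
      unfolding P using ne2 hpos by (simp add: snake_eq_Nil)
    also have "\<dots> = last p2 + (h (last p2) - 1) * d"
      using last_snake[of p2 h d True] ne2 hpos p2 r that by simp
    finally show ?thesis
      using h2 ne2 by simp
  qed
qed

text \<open>Climb column 0, cross to the top of column d - 1, and return through the other columns. The
  step from the short columns back to the tall ones has to be at the bottom, whence the
  condition on d and q.\<close>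

lemma lift_odd:
  fixes d q r :: nat and p1 p2 :: "nat list"
  defines "h \<equiv> \<lambda>c. if c < r then Suc q else q"
  defines "P \<equiv> snake d h True [0] @ snake d h False p1 @ snake d h True p2"
  assumes p1: "set p1 = {r..<d}" "length p1 = d - r" "hd p1 = d - 1"
    and p2: "set p2 = {1..<r}" "length p2 = r - 1"
    and r: "r < d" "odd r" and q: "q > 0" and c: "r = 1 \<or> even d \<or> q = 1"
  shows "set P = {..<q * d + r}" "hd P = 0"
    and "linear_edge_lengths P =
      add_mset 1 (linear_edge_lengths (p1 @ p2)) + replicate_mset ((q - 1) * d + r) d"
    and "r = 1 \<Longrightarrow> odd d \<Longrightarrow> last P = last p1 + (q - 1) * d"
proof -
  have r0: "r > 0"
    using r by (auto elim: oddE)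
  have h1: "h c = q" if "c \<in> set p1" for c
    using that p1 by (simp add: h_def)
  have h2: "h c = Suc q" if "c \<in> set p2" for c
    using that p2 by (simp add: h_def)
  have ne1: "p1 \<noteq> []"
    using p1 r by auto
  have hpos: "h c > 0" for c
    using q by (simp add: h_def)
  have "{0} \<union> {r..<d} \<union> {1..<r} = {..<d}"
    using r r0 by auto
  then have "set ([0] @ p1 @ p2) = {..<d}"
    using p1 p2 by auto
  then have "set (snake d h True ([0] @ p1 @ p2)) = {..<q * d + r}"
    unfolding set_snake using residue_classes_cover[of r d q] r by (simp add: h_def)
  then show "set P = {..<q * d + r}"
    unfolding P_def set_append set_snake by auto
  have ne: "snake d h True [0] \<noteq> []" "snake d h False p1 \<noteq> []"
    using ne1 hpos by (simp_all add: snake_eq_Nil del: snake.simps)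
  show "hd P = 0"
    unfolding P_def using ne hd_snake[of "[0]" h d True] hpos by (simp del: snake.simps)
  have E0: "linear_edge_lengths (snake d h True [0]) = replicate_mset q d"
    using linear_edge_lengths_snake[of "[0]" "Suc q" h d True] r0 by (simp add: h_def del: snake.simps)
  have E1: "linear_edge_lengths (snake d h False p1) =
      linear_edge_lengths p1 + replicate_mset ((q - 1) * (d - r)) d"
    using linear_edge_lengths_snake[of p1 q h d False] ne1 q h1 p1 by simp
  have "last (snake d h True [0]) = q * d"
    using last_snake[of "[0]" h d True] hpos r0 by (simp add: h_def del: snake.simps)
  moreover have "hd (snake d h False p1) = d - 1 + (q - 1) * d"
    using hd_snake[of p1 h d False] h1[OF hd_in_set[OF ne1]] ne1 q unfolding p1(3) by simp
  \<comment> \<open>\<open>q * d\<close> is the top of the tall column 0, and the top of the short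
    column \<open>d - 1\<close> is the vertex just below it; hence the bridge of length 1.\<close>
  moreover have "q * d = Suc (d - 1 + (q - 1) * d)"
    using q r by (cases q) auto
  ultimately have link: "linear_length (last (snake d h True [0]), hd (snake d h False p1)) = 1"
    by (simp add: linear_length_nat del: snake.simps)
  have E01: "linear_edge_lengths (snake d h True [0] @ snake d h False p1) =
      add_mset 1 (linear_edge_lengths p1) + replicate_mset (q + (q - 1) * (d - r)) d"
    unfolding linear_edge_lengths_append2[OF ne] link E0 E1 replicate_mset_add
    by (simp only: union_mset_add_mset_left union_mset_add_mset_right ac_simps)
  show "linear_edge_lengths P =
      add_mset 1 (linear_edge_lengths (p1 @ p2)) + replicate_mset ((q - 1) * d + r) d"
  proof (cases "p2 = []")
    case True
    then have "r = 1"
      using p2 r0 by simp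
    then have n: "(q - 1) * d + r = q + (q - 1) * (d - r)"
      using q r by (cases q; cases d) auto
    show ?thesis
      using E01 True unfolding n by (simp add: P_def del: snake.simps(2))
  next
    case False
    then have r1: "r \<noteq> 1"
      using p2 by auto
    have E2: "linear_edge_lengths (snake d h True p2) =
        linear_edge_lengths p2 + replicate_mset (q * (r - 1)) d"
      using linear_edge_lengths_snake[of p2 "Suc q" h d True] False h2 p2 by simp
    have "last (snake d h False p1) = last p1"
    \<comment> \<open>If \<open>q = 1\<close>, the short columns are single vertices. Otherwise
      \<open>d\<close> is even, so the number \<open>d - r\<close> of short columns is odd, and the
      last of them is descended like the first.\<close>
    proof (cases "q = 1")
      case True
      then show ?thesis
        using last_snake[of p1 h d False] ne1 hpos h1 by simp
    next
      case False
      then have "odd (length p1)"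
        using c r1 r p1 by auto
      then show ?thesis
        using last_snake[of p1 h d False] ne1 hpos h1 q by simp
    qed
    then have l: "last (snake d h True [0] @ snake d h False p1) = last p1"
      using ne by (simp del: snake.simps)
    have f: "hd (snake d h True p2) = hd p2"
      using hd_snake[of p2 h d True] False hpos by simp
    have ne': "snake d h True [0] @ snake d h False p1 \<noteq> []" "snake d h True p2 \<noteq> []"
      using ne False hpos by (simp_all add: snake_eq_Nil del: snake.simps)
    \<comment> \<open>These substitutions remove the truncated subtractions.\<close>
    obtain q' e r' where "q = Suc q'" "d = r + e" "r = Suc r'"
      using q r r0 by (metis gr0_implies_Suc less_imp_add_positive)
    then have n: "(q - 1) * d + r = q + (q - 1) * (d - r) + q * (r - 1)"
      by (simp add: algebra_simps)
    have "linear_edge_lengths ((snake d h True [0] @ snake d h False p1) @ snake d h True p2) =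
        add_mset 1 (linear_edge_lengths (p1 @ p2)) + replicate_mset ((q - 1) * d + r) d"
      unfolding linear_edge_lengths_append2[OF ne'] linear_edge_lengths_append2[OF ne1 False]
        l f E01 E2 n replicate_mset_add
      by (simp only: union_mset_add_mset_left union_mset_add_mset_right ac_simps add_mset_commute)
    then show ?thesis
      by (simp only: P_def append_assoc)
  qed
  show "last P = last p1 + (q - 1) * d" if "r = 1" "odd d"
  proof -
    have "p2 = []"
      using that p2 by simp
    then have "last P = last (snake d h False p1)"
      unfolding P_def using ne by (simp del: snake.simps(2))
    also have "\<dots> = last p1 + (h (last p1) - 1) * d"
      using last_snake[of p1 h d False] ne1 hpos p1 r that by simp
    finally show ?thesis
      using h1 ne1 by simp
  qed
qed

text \<open>A Posa rotation: the tail of the path behind m is reversed.\<close>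

lemma rotate_end:
  "linear_edge_lengths (p @ [m] @ rev q) + linear_edge_lengths (m # q) =
   linear_edge_lengths (p @ [m] @ q) + linear_edge_lengths (m # rev q)"
  using linear_edge_lengths_append[of "p @ [m]" q] linear_edge_lengths_append[of "p @ [m]" "rev q"]
  by simp

text \<open>As \<open>d\<close> is odd, the snake climbs its last column \<open>w\<close> and
  descends the column \<open>u\<close> before it. The end of the path can thus be joined
  horizontally to column \<open>u\<close>, and a vertical edge there is dropped: one copy of
  \<open>d\<close> is traded for a length \<open>l\<close> already used by the order of the
  residues.\<close>

lemma lift_rotate:
  fixes d q r :: nat and p1 p2 :: "nat list"
  assumes p1: "set p1 = {..<r}" "length p1 = r" and p2: "set p2 = {r..<d}" "length p2 = d - r"
    and r: "r < d" "even r" and q: "q > 1" and d: "odd d" "d > 1"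
  shows "\<exists>P l. set P = {..<q * d + r} \<and> hd P = hd (p1 @ p2) \<and>
    l \<in># linear_edge_lengths (p1 @ p2) \<and> linear_edge_lengths P =
      add_mset l (linear_edge_lengths (p1 @ p2)) + replicate_mset ((q - 1) * d + r - 1) d"
proof -
  define h where "h = (\<lambda>c. if c < r then Suc q else q)"
  define S where "S = snake d h True (p1 @ p2)"
  have q0: "q > 0"
    using q by simp
  note S = lift_even[OF p1 p2 r q0, folded h_def, folded S_def]
  have len: "length (p1 @ p2) = d"
    using p1 p2 r by simp
  obtain ps u w where ps: "p1 @ p2 = ps @ [u, w]"
  proof -
    have "Suc (Suc (d - 2)) = length (p1 @ p2)"
      using len d by simp
    then show ?thesis
      using that by (metis append.assoc append_Cons append_Nil length_Suc_conv_rev)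
  qed
  have "p2 \<noteq> []"
    using p2 r by auto
  then have "w = last p2"
    using ps by (metis last_ConsL last_ConsR last_appendR list.distinct(1))
  then have "w \<in> set p2"
    using \<open>p2 \<noteq> []\<close> by simp
  then have hw: "h w = q"
    using p2 by (simp add: h_def)
  have hu: "h u = q \<or> h u = Suc q"
    by (simp add: h_def)
  \<comment> \<open>\<open>m\<close> is the vertex of column \<open>u\<close> level with the top of
    column \<open>w\<close>.\<close>
  define m where "m = u + (q - 1) * d"
  define X where "X = snake d h True ps @ rev (map (\<lambda>k. u + k * d) [q..<h u])"
  define Y where "Y = rev (map (\<lambda>k. u + k * d) [0..<q - 1]) @ map (\<lambda>k. w + k * d) [0..<q]"
  have "d = length ps + 2"
    using len ps by simp
  then have "odd (length ps)"
    using d by simp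
  \<comment> \<open>Column \<open>u\<close> has at most one vertex above \<open>m\<close>, which
    belongs to \<open>X\<close>; those below \<open>m\<close> open \<open>Y\<close>.\<close>
  have up: "[0..<h u] = [0..<q - 1] @ [q - 1] @ [q..<h u]"
    using hu q by (cases q) auto
  have SXY: "S = X @ [m] @ Y"
    using \<open>odd (length ps)\<close> hw unfolding S_def ps snake_append X_def Y_def m_def
    by (simp add: up)
  have hdY: "hd Y = u + (q - 2) * d"
    using q unfolding Y_def by (simp add: hd_append hd_rev last_map numeral_2_eq_2)
  have lastY: "last Y = w + (q - 1) * d"
    using q unfolding Y_def by (simp add: last_map)
  have neY: "Y \<noteq> []"
    using q by (simp add: Y_def)
  define l where "l = linear_length (u, w)"
  have "q - 1 = Suc (q - 2)"
    using q by simp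
  then have Y1: "linear_edge_lengths (m # Y) = add_mset d (linear_edge_lengths Y)"
    using neY hdY by (cases Y) (auto simp: m_def linear_length_nat)
  have "rev Y \<noteq> []" "hd (rev Y) = w + (q - 1) * d"
    using neY lastY by (simp_all add: hd_rev)
  then have "linear_edge_lengths (m # rev Y) = add_mset l (linear_edge_lengths (rev Y))"
    by (cases "rev Y") (auto simp: m_def l_def linear_length_nat)
  then have Y2: "linear_edge_lengths (m # rev Y) = add_mset l (linear_edge_lengths Y)"
    by (simp add: linear_edge_lengths_rev)
  define P where "P = X @ [m] @ rev Y"
  have "linear_edge_lengths P + {#d#} = linear_edge_lengths S + {#l#}"
    using rotate_end[of X m Y] unfolding Y1 Y2 SXY P_def by simp
  moreover have "(q - 1) * d + r = Suc ((q - 1) * d + r - 1)"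
    using q d by (cases "(q - 1) * d") auto
  then have "replicate_mset ((q - 1) * d + r) d = add_mset d (replicate_mset ((q - 1) * d + r - 1) d)"
    by (metis replicate_mset_Suc)
  ultimately have "linear_edge_lengths P =
      add_mset l (linear_edge_lengths (p1 @ p2)) + replicate_mset ((q - 1) * d + r - 1) d"
    unfolding S(3) by simp
  moreover have "set P = {..<q * d + r}"
    using S(1) unfolding SXY P_def by simp
  moreover have "hd P = hd (p1 @ p2)"
    using S(2) unfolding SXY P_def by (cases X) simp_all
  moreover have "l \<in># linear_edge_lengths (p1 @ p2)"
    unfolding ps l_def by (cases "ps = []") (simp_all add: linear_edge_lengths_append)
  ultimately show ?thesis
    by blast
qed

subsection \<open>Lifting realizations\<close>

lemma realizesI: "set p = {..<Suc (size M)} \<Longrightarrow> linear_edge_lengths p = M \<Longrightarrow> realizes p M"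
  by (simp add: realizes_def lessThan_Suc_atMost)

lemma has_standardI: "realizes p M \<Longrightarrow> hd p = 0 \<Longrightarrow> has_standard M"
  by (auto simp: has_standard_def)

text \<open>A perfect first part visits all residues below \<open>size M\<close> before crossing to
  the others, so the cut at \<open>size M\<close> can separate tall columns from short ones.\<close>

lemma column_order:
  assumes "has_perfect M" "has_standard N"
  shows "\<exists>p q. set p = {..<size M} \<and> length p = size M \<and>
    set q = {size M..<Suc (size (M + N))} \<and> length q = Suc (size N) \<and>
    hd (p @ q) = 0 \<and> linear_edge_lengths (p @ q) = M + N"
proof -
  obtain p q where p: "realizes p M" "hd p = 0" "last p = size M" and q: "realizes q N" "hd q = 0"
    using assms by (auto simp: has_standard_def has_perfect_def)
  note J = realizes_join[OF p(1,3) q]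
  have "set q = {..size N}"
    using q(1) by (simp add: realizes_def)
  then have "set (map ((+) (size M)) q) = {size M..<Suc (size (M + N))}"
    by (simp add: lessThan_Suc_atMost[symmetric] lessThan_atLeast0 image_add_atLeastLessThan add.commute)
  moreover have "hd (butlast p @ map ((+) (size M)) q) = 0"
    using J(2) p(2) by simp
  moreover have "linear_edge_lengths (butlast p @ map ((+) (size M)) q) = M + N"
    using J(1) by (simp add: realizes_def)
  moreover have "length (butlast p) = size M" "length (map ((+) (size M)) q) = Suc (size N)"
    using realizes_length[OF p(1)] realizes_length[OF q(1)] by simp_all
  ultimately show ?thesis
    using J(4) by blast
qed

lemma has_standard_lift_even:
  fixes q :: nat
  assumes "has_perfect M" "has_standard N" "even (size M)" "q > 0"
  defines "d \<equiv> Suc (size (M + N))"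
  shows "has_standard (M + N + replicate_mset ((q - 1) * d + size M) d)"
proof -
  obtain p1 p2 where p: "set p1 = {..<size M}" "length p1 = size M" "set p2 = {size M..<d}"
    "length p2 = Suc (size N)" "hd (p1 @ p2) = 0" "linear_edge_lengths (p1 @ p2) = M + N"
    using column_order[OF assms(1,2)] unfolding d_def by blast
  have "length p2 = d - size M" "size M < d"
    using p by (simp_all add: d_def)
  note S = lift_even[OF p(1-3) this assms(3,4)]
  have n: "q * d + size M = Suc (size (M + N + replicate_mset ((q - 1) * d + size M) d))"
    using \<open>q > 0\<close> by (cases q) (simp_all add: d_def)
  show ?thesis
    by (rule has_standardI[OF realizesI[OF S(1)[unfolded n] S(3)[unfolded p(6)]] S(2)[unfolded p(5)]])
qed

lemma has_standard_lift_rotate: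
  fixes q :: nat
  assumes "has_perfect M" "has_standard N" "even (size M)" "q > 1"
  defines "d \<equiv> Suc (size (M + N))"
  assumes "odd d" "d > 1"
  shows "\<exists>l. l \<in># M + N \<and>
    has_standard (add_mset l (M + N) + replicate_mset ((q - 1) * d + size M - 1) d)"
proof -
  obtain p1 p2 where p: "set p1 = {..<size M}" "length p1 = size M" "set p2 = {size M..<d}"
    "length p2 = Suc (size N)" "hd (p1 @ p2) = 0" "linear_edge_lengths (p1 @ p2) = M + N"
    using column_order[OF assms(1,2)] unfolding d_def by blast
  have "length p2 = d - size M" "size M < d"
    using p by (simp_all add: d_def)
  from lift_rotate[OF p(1-3) this assms(3,4,6,7)]
  obtain P l where P: "set P = {..<q * d + size M}" "hd P = 0" "l \<in># M + N"
    "linear_edge_lengths P = add_mset l (M + N) + replicate_mset ((q - 1) * d + size M - 1) d"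
    using p(5,6) by auto
  have "q * d = d + (q - 1) * d" "(q - 1) * d > 0"
    using \<open>q > 1\<close> \<open>d > 1\<close> by (cases q; simp)+
  moreover have "size (add_mset l (M + N) + replicate_mset ((q - 1) * d + size M - 1) d) =
      d + ((q - 1) * d + size M - 1)"
    by (simp add: d_def)
  ultimately have n: "q * d + size M =
      Suc (size (add_mset l (M + N) + replicate_mset ((q - 1) * d + size M - 1) d))"
    by arith
  show ?thesis
    by (intro exI[of _ l] conjI P(3)) (rule has_standardI[OF realizesI[OF P(1)[unfolded n] P(4)] P(2)])
qed

lemma reflect_interval:
  fixes k l d :: nat
  assumes "k \<le> l" "l < d"
  shows "(-) (d - 1) ` {k..<l} = {d - l..<d - k}"
proof (intro equalityI subsetI)
  fix z assume "z \<in> {d - l..<d - k}"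
  then show "z \<in> (-) (d - 1) ` {k..<l}"
    using assms by (intro image_eqI[of _ _ "d - 1 - z"]) auto
qed (use assms in auto)

text \<open>The order concerns only \<open>d - 1\<close> residues, since column 0 is visited
  separately. The reflection \<open>c \<mapsto> d - 1 - c\<close> makes it start at
  \<open>d - 1\<close> and turns the first \<open>size M\<close> residues into the short columns,
  which leaves \<open>d - size M\<close> tall ones including column 0.\<close>

lemma has_standard_lift_odd:
  fixes q d :: nat
  assumes "has_perfect M" "has_standard N" "d = size (M + N) + 2" "odd (d - size M)" "q > 0"
    and "even d \<or> q = 1" "size M > 0"
  shows "has_standard (add_mset 1 (M + N) + replicate_mset ((q - 1) * d + (d - size M)) d)"
proof -
  obtain p1 p2 where p: "set p1 = {..<size M}" "length p1 = size M" "set p2 = {size M..<d - 1}"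
    "length p2 = Suc (size N)" "hd (p1 @ p2) = 0" "linear_edge_lengths (p1 @ p2) = M + N"
    using column_order[OF assms(1,2)] assms(3) by auto
  have d: "size M < d - 1" "d > 1"
    using assms(3) by auto
  define r where "r = d - size M"
  let ?f = "(-) (d - 1)"
  have s1: "set (map ?f p1) = {r..<d}"
    using reflect_interval[of 0 "size M" d] d p(1) by (simp add: r_def lessThan_atLeast0)
  have s2: "set (map ?f p2) = {1..<r}"
    using reflect_interval[of "size M" "d - 1" d] d p(3) by (simp add: r_def)
  have "p1 \<noteq> []"
    using p(2) assms(7) by auto
  then have h: "hd (map ?f p1) = d - 1"
    using p(5) by (simp add: hd_map)
  have l: "length (map ?f p1) = d - r" "length (map ?f p2) = r - 1"
    using p d assms(3) by (simp_all add: r_def)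
  have r: "r < d" "odd r"
    using assms(4,7) d by (simp_all add: r_def)
  have c: "r = 1 \<or> even d \<or> q = 1"
    using assms(6) by blast
  note S = lift_odd[OF s1 l(1) h s2 l(2) r assms(5) c]
  have "set (p1 @ p2) \<subseteq> {..d - 1}"
    using p(1,3) d by auto
  then have "linear_edge_lengths (map ?f (p1 @ p2)) = M + N"
    using linear_edge_lengths_reflect[of "p1 @ p2" "d - 1"] p(6) by (simp only:)
  then have E: "linear_edge_lengths (map ?f p1 @ map ?f p2) = M + N"
    by simp
  have n: "q * d + r = Suc (size (add_mset 1 (M + N) + replicate_mset ((q - 1) * d + r) d))"
    using \<open>q > 0\<close> assms(3) by (cases q) simp_all
  show ?thesis
    unfolding r_def[symmetric]
    by (rule has_standardI[OF realizesI[OF S(1)[unfolded n] S(3)[unfolded E]] S(2)])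
qed

text \<open>Only column 0 is tall here. For odd \<open>d\<close> the number of the other columns is
  even, so the last one is climbed; its top is recorded because the path will be prolonged from
  there.\<close>

lemma realizes_lift_one:
  fixes q d :: nat
  assumes "realizes p N" "hd p = 0" "d = size N + 2" "q > 0"
  shows "\<exists>P. realizes P (add_mset 1 N + replicate_mset ((q - 1) * d + 1) d) \<and> hd P = 0 \<and>
    (odd d \<longrightarrow> last P = d - 1 - last p + (q - 1) * d)"
proof -
  let ?f = "(-) (d - 1)"
  have sp: "set p = {..<d - 1}"
    using assms(1,3) by (simp add: realizes_def lessThan_Suc_atMost[symmetric])
  have d: "d > 1"
    using assms(3) by auto
  have s1: "set (map ?f p) = {1..<d}"
    using reflect_interval[of 0 "d - 1" d] d sp by (simp add: lessThan_atLeast0)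
  have l: "length (map ?f p) = d - 1"
    using realizes_length[OF assms(1)] assms(3) by simp
  have ne: "p \<noteq> []"
    using assms(1) realizes_nonempty by auto
  then have h: "hd (map ?f p) = d - 1"
    using assms(2) by (simp add: hd_map)
  have s2: "set ([] :: nat list) = {1..<1}" "length ([] :: nat list) = 1 - 1" "odd (1 :: nat)"
    by simp_all
  have c: "1 = (1 :: nat) \<or> even d \<or> q = 1"
    by simp
  note S = lift_odd[OF s1 l h s2(1,2) d s2(3) assms(4) c]
  have "set p \<subseteq> {..d - 1}"
    unfolding sp by auto
  moreover have "linear_edge_lengths p = N"
    using assms(1) by (simp add: realizes_def)
  ultimately have "linear_edge_lengths (map ?f p) = N"
    by (simp only: linear_edge_lengths_reflect)
  then have E: "linear_edge_lengths (map ?f p @ []) = N"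
    by simp
  have n: "q * d + 1 = Suc (size (add_mset 1 N + replicate_mset ((q - 1) * d + 1) d))"
    using \<open>q > 0\<close> assms(3) by (cases q) simp_all
  have "last (map ?f p) = d - 1 - last p"
    using ne by (simp add: last_map)
  note last = S(4)[OF refl, unfolded this]
  show ?thesis
    by (intro exI conjI impI) (rule realizesI[OF S(1)[unfolded n] S(3)[unfolded E]] S(2) last, assumption?)+
qed

text \<open>\<open>K n M\<close> stands for the constraint that an application puts on the lengths
  \<open>M\<close> in an order of \<open>n\<close> residues. The order must exist for every cut
  \<open>r\<close>, because \<open>c\<close> dictates the number of tall columns. The conclusion
  lists the costs: nothing, a bridge of length 1, or one repeated length \<open>l\<close> from a
  rotation.\<close>

lemma has_standard_with_copies:
  fixes d c :: nat and K :: "nat \<Rightarrow> nat multiset \<Rightarrow> bool"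
  assumes d: "d > 1"
    and K: "\<And>n r. n = d - 1 \<or> n = d \<Longrightarrow> r < n \<Longrightarrow>
      \<exists>M N. has_perfect M \<and> size M = r \<and> has_standard N \<and> Suc (size (M + N)) = n \<and> K n (M + N)"
  shows "\<exists>M. has_standard (M + replicate_mset c d) \<and>
    (K d M \<or> (\<exists>N. K (d - 1) N \<and> M = add_mset 1 N) \<or> (\<exists>N l. K d N \<and> l \<in># N \<and> M = add_mset l N))"
proof -
  \<comment> \<open>Columns of height \<open>q\<close> contain \<open>(q - 1) * d\<close> vertical
    edges in all, and each of the \<open>r\<close> tall ones has one more; hence the successor of
    the quotient.\<close>
  define q where "q = Suc (c div d)"
  define r where "r = c mod d"
  have c: "c = (q - 1) * d + r"
    by (simp add: q_def r_def)
  have q: "q > 0" and r: "r < d"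
    using d by (simp_all add: q_def r_def)
  have "even r \<or> r = 1 \<or> r > 1" "q = 1 \<or> q > 1"
    using q by (cases "r = 0"; auto)+
  then consider "even r" | "r = 1" | "odd r" "r > 1" "even d \<or> q = 1" | "odd r" "odd d" "q > 1"
    by blast
  then show ?thesis
  proof cases
    case 1
    obtain M N where *: "has_perfect M" "size M = r" "has_standard N" "Suc (size (M + N)) = d" "K d (M + N)"
      using K[of d r] r by blast
    have "has_standard (M + N + replicate_mset c d)"
      using has_standard_lift_even[OF *(1,3) _ q] 1 by (simp only: *(2,4) c)
    then show ?thesis
      using *(5) by blast
  next
    case 2
    have "0 < d - 1"
      using d by simp
    then obtain M N where *: "has_perfect M" "has_standard N" "Suc (size (M + N)) = d - 1" "K (d - 1) (M + N)"
      using K[of "d - 1" 0] by blast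
    obtain p where p: "realizes p (M + N)" "hd p = 0"
      using has_standard_add[OF *(1,2)] unfolding has_standard_def by blast
    have "d = size (M + N) + 2"
      using *(3) by simp
    from realizes_lift_one[OF p this q] have "has_standard (add_mset 1 (M + N) + replicate_mset c d)"
      unfolding has_standard_def c 2 by blast
    then show ?thesis
      using *(4) by blast
  next
    case 3
    have "d - r < d - 1"
      using 3(2) r by arith
    then obtain M N where *: "has_perfect M" "size M = d - r" "has_standard N"
        "Suc (size (M + N)) = d - 1" "K (d - 1) (M + N)"
      using K[of "d - 1" "d - r"] by blast
    have r': "d - size M = r" "size M > 0" "d = size (M + N) + 2"
      using *(2,4) r by simp_all
    have "has_standard (add_mset 1 (M + N) + replicate_mset c d)"
      using has_standard_lift_odd[OF *(1,3) r'(3) _ q 3(3) r'(2)] 3(1) unfolding r'(1) c by blast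
    then show ?thesis
      using *(5) by blast
  next
    case 4
    \<comment> \<open>One more tall column makes their number even, and the rotation takes the
      surplus copy of \<open>d\<close> away. Since \<open>d\<close> is odd, a short column
      remains.\<close>
    have "Suc r \<noteq> d"
      using 4 by auto
    then have "Suc r < d"
      using r by simp
    then obtain M N where *: "has_perfect M" "size M = Suc r" "has_standard N"
        "Suc (size (M + N)) = d" "K d (M + N)"
      using K[of d "Suc r"] by blast
    have ev: "even (size M)" and e: "(q - 1) * d + Suc r - 1 = c"
      using 4 *(2) by (simp_all add: c)
    have "\<exists>l. l \<in># M + N \<and> has_standard (add_mset l (M + N) + replicate_mset c d)"
      by (rule has_standard_lift_rotate[OF *(1,3) ev 4(3), unfolded *(4), OF 4(2) d, unfolded *(2) e])
    then show ?thesis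
      using *(5) by blast
  qed
qed

lemma has_perfect_append:
  assumes "realizes p M" "hd p = 0" "last p + l = Suc (size M)"
  shows "has_perfect (add_mset l M)"
proof -
  have "p \<noteq> []" and p: "set p = {..size M}" "linear_edge_lengths p = M"
    using assms(1) realizes_nonempty by (auto simp: realizes_def)
  have "linear_length (last p, Suc (size M)) = l"
    using assms(3) by (simp add: linear_length_nat flip: assms(3))
  then have "realizes (p @ [Suc (size M)]) (add_mset l M)"
    using p \<open>p \<noteq> []\<close> by (simp add: realizes_def linear_edge_lengths_append atMost_Suc)
  then show ?thesis
    unfolding has_perfect_def using \<open>p \<noteq> []\<close> assms(2) by (intro exI[of _ "p @ [Suc (size M)]"]) simp
qed

lemma realizes_upt: "realizes [0..<Suc n] (replicate_mset n 1)"
  using linear_edge_lengths_interval[of 0 1 "Suc n"]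
  by (auto simp: realizes_def simp del: upt_Suc)

subsection \<open>Copies of 1 and x\<close>

context
  fixes x :: nat
  assumes x: "odd x" "x > 1"
begin

lemma x_ge_3: "x \<ge> 3"
  using x by (cases "x = 2") auto

text \<open>All \<open>x\<close> columns have height \<open>j + 1\<close> and are taken in natural
  order; as \<open>x\<close> is odd, the last one is climbed, and its top is the largest
  vertex.\<close>

lemma has_perfect_x_copies: "has_perfect (replicate_mset (x - 1) 1 + replicate_mset (j * x) x)"
proof -
  have "set ([] :: nat list) = {..<0}" "length ([] :: nat list) = 0"
    "set [0..<x] = {0..<x}" "length [0..<x] = x - 0" "0 < x" "even (0 :: nat)" "0 < Suc j"
    using x by auto
  note S = lift_even[OF this]
  have n: "Suc (x - 1) = x"
    using x by simp
  let ?M = "replicate_mset (x - 1) 1 + replicate_mset (j * x) x"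
  have E: "linear_edge_lengths [0..<x] = replicate_mset (x - 1) 1"
    using realizes_upt[of "x - 1"] unfolding n by (simp add: realizes_def)
  have "Suc j * x + 0 = Suc (size ?M)"
    using x by simp
  then have "realizes (snake x (\<lambda>c. if c < 0 then Suc (Suc j) else Suc j) True ([] @ [0..<x])) ?M"
    unfolding realizes_def using S(1,3) E by (simp only: lessThan_Suc_atMost) simp
  moreover have "last [0..<x] + j * x = size ?M"
    using x by simp
  moreover have "hd [0..<x] = 0"
    using x by simp
  ultimately show ?thesis
    unfolding has_perfect_def using S(2) S(4)[OF x(1)] by (intro exI conjI) simp_all
qed

text \<open>Column 0 is followed by columns \<open>x - 1\<close>, ..., 1, so the path ends at the
  top of column 1.\<close>

lemma lift_one_x:
  "\<exists>P. realizes P (replicate_mset (x - 1) 1 + replicate_mset (j * x + 1) x) \<and> hd P = 0 \<and>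
    last P = 1 + j * x"
proof -
  have d: "x = size (replicate_mset (x - 2) (1 :: nat)) + 2" and n: "x - 1 = Suc (x - 2)"
    using x by simp_all
  have "hd [0..<Suc (x - 2)] = 0"
    using hd_upt[of 0 "Suc (x - 2)"] by (simp del: upt_Suc)
  from realizes_lift_one[OF realizes_upt this d, of "Suc j"] x(1)
  obtain P where "realizes P (add_mset 1 (replicate_mset (x - 2) 1) + replicate_mset (j * x + 1) x)"
    "hd P = 0" "last P = x - 1 - last [0..<Suc (x - 2)] + j * x"
    by auto
  then show ?thesis
    unfolding n by (intro exI[of _ P]) auto
qed

text \<open>The top of column 1 is \<open>x\<close> below the first vertex outside the interval;
  appending that vertex makes the path perfect.\<close>

lemma has_perfect_x_copies_2: "has_perfect (replicate_mset (x - 1) 1 + replicate_mset (j * x + 2) x)"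
proof -
  obtain P where P: "realizes P (replicate_mset (x - 1) 1 + replicate_mset (j * x + 1) x)" "hd P = 0"
      "last P = 1 + j * x"
    using lift_one_x by blast
  have "last P + x = Suc (size (replicate_mset (x - 1) 1 + replicate_mset (j * x + 1) x))"
    using P(3) x by simp
  from has_perfect_append[OF P(1,2) this] show ?thesis
    by simp
qed

text \<open>These are the remainders for which a lift of the natural order of the residues gets by
  with \<open>x - 1\<close> ones, without a rotation.\<close>

lemma has_standard_x_copies:
  assumes "even (b mod x) \<or> b mod x = 1"
  shows "has_standard (replicate_mset (x - 1) 1 + replicate_mset b x)"
proof -
  have b: "b = b div x * x + b mod x" and r: "b mod x < x"
    using x by simp_all
  show ?thesis
  proof (cases "b mod x = 1")
    case True
    then have "b div x * x + 1 = b"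
      using b by linarith
    then show ?thesis
      using lift_one_x[of "b div x"] unfolding has_standard_def by metis
  next
    case False
    define r where "r = b mod x"
    define M N where "M = replicate_mset r (1 :: nat)" and "N = replicate_mset (x - 1 - r) (1 :: nat)"
    have "has_perfect M" "has_standard N" "even (size M)" "0 < Suc (b div x)"
      using has_perfect_ones has_perfect_imp_has_standard assms False
      by (auto simp: M_def N_def r_def)
    note S = has_standard_lift_even[OF this]
    have MN: "M + N = replicate_mset (x - 1) 1"
      using \<open>b mod x < x\<close> unfolding M_def N_def r_def by (simp flip: replicate_mset_add)
    then have "Suc (size (M + N)) = x"
      using x by simp
    then show ?thesis
      using S b MN by (simp add: M_def r_def)
  qed
qed

lemma has_standard_ones_x_copies:
  assumes "a \<ge> x"
  shows "has_standard (replicate_mset a 1 + replicate_mset b x)"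
proof -
  have "\<exists>M. has_standard (M + replicate_mset b x) \<and>
    (M = replicate_mset (x - 1) 1 \<or>
     (\<exists>N. N = replicate_mset (x - 1 - 1) 1 \<and> M = add_mset 1 N) \<or>
     (\<exists>N l. N = replicate_mset (x - 1) 1 \<and> l \<in># N \<and> M = add_mset l N))"
  proof (rule has_standard_with_copies[where K = "\<lambda>n M. M = replicate_mset (n - 1) 1"])
    fix n r assume n: "n = x - 1 \<or> n = x" and r: "r < n"
    have "has_perfect (replicate_mset r 1)" "has_standard (replicate_mset (n - 1 - r) 1)"
      using has_perfect_ones has_perfect_imp_has_standard by blast+
    moreover have "replicate_mset r 1 + replicate_mset (n - 1 - r) 1 = replicate_mset (n - 1) (1 :: nat)"
      using r by (simp flip: replicate_mset_add)
    moreover have "Suc (size (replicate_mset (n - 1) (1 :: nat))) = n"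
      using r by simp
    ultimately show "\<exists>M N. has_perfect M \<and> size M = r \<and> has_standard N \<and> Suc (size (M + N)) = n \<and>
        M + N = replicate_mset (n - 1) 1"
      by (metis size_replicate_mset)
  qed (fact x)
  then obtain M where M: "has_standard (M + replicate_mset b x)"
    and "M = replicate_mset (x - 1) 1 \<or> M = add_mset 1 (replicate_mset (x - 1 - 1) 1) \<or>
      M = add_mset 1 (replicate_mset (x - 1) 1)"
    by (auto split: if_splits)
  then have "M = replicate_mset (x - 1) 1 \<or> M = replicate_mset (Suc (x - 1 - 1)) 1 \<or>
      M = replicate_mset (Suc (x - 1)) 1"
    by simp
  \<comment> \<open>A rotation raises the number of ones from \<open>x - 1\<close> to
    \<open>x\<close>, which is where the bound on \<open>a\<close> comes from. Surplus ones form a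
    perfect path in front.\<close>
  then obtain j where j: "M = replicate_mset j 1" "j \<le> x"
    using x by (metis Suc_diff_1 diff_le_self le_refl less_imp_le_nat zero_less_diff zero_less_one
      less_trans)
  have "replicate_mset (a - j) 1 + (M + replicate_mset b x) = replicate_mset a 1 + replicate_mset b x"
  proof -
    have "replicate_mset (a - j) 1 + replicate_mset j 1 = replicate_mset a (1 :: nat)"
      using j assms by (simp flip: replicate_mset_add)
    then show ?thesis
      by (simp only: j(1) add.assoc[symmetric])
  qed
  then show ?thesis
    using has_standard_add[OF has_perfect_ones M] by metis
qed

text \<open>Every size from \<open>x\<close> on is reached by putting ones in front of one of the
  two perfect blocks with \<open>x - 1\<close> ones. At most \<open>x - 3\<close> of them precede
  the block with two extra copies of \<open>x\<close>, hence the bound \<open>2 * x - 4\<close>; the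
  alternative \<open>u \<le> x\<close> matters when \<open>x = 3\<close>.\<close>

lemma has_perfect_ones_x_copies:
  assumes "r \<ge> x"
  shows "\<exists>u b. has_perfect (replicate_mset u 1 + replicate_mset b x) \<and> u + b = r \<and>
    x \<le> u + 1 \<and> (u + 4 \<le> 2 * x \<or> u \<le> x)"
proof -
  define i where "i = r div x - 1"
  have "r div x > 0"
    using assms x by (simp add: div_greater_zero_iff)
  then have "r div x = Suc i"
    by (simp add: i_def)
  then have r: "r = i * x + x + r mod x"
    using div_mult_mod_eq[of r x] by (simp add: algebra_simps)
  have "r mod x < x"
    using x by simp
  then consider "r mod x = x - 1" | "r mod x = 0" | "0 < r mod x" "r mod x < x - 1"
    by linarith
  then show ?thesis
  proof cases
    case 1
    show ?thesis
      by (rule exI[of _ "x - 1"], rule exI[of _ "Suc i * x"]) (use 1 has_perfect_x_copies[of "Suc i"] r x in auto)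
  next
    case 2
    have "replicate_mset 1 1 + replicate_mset (x - 1) 1 = replicate_mset x (1 :: nat)"
      using x by (cases x) simp_all
    then have P: "has_perfect (replicate_mset x 1 + replicate_mset (i * x) x)"
      using has_perfect_add[OF has_perfect_ones has_perfect_x_copies, of 1 i]
      by (metis add.assoc)
    show ?thesis
      by (rule exI[of _ x], rule exI[of _ "i * x"]) (use P 2 r x in auto)
  next
    case 3
    let ?k = "r mod x - 1"
    have "replicate_mset ?k 1 + replicate_mset (x - 1) 1 = replicate_mset (?k + (x - 1)) (1 :: nat)"
      by (simp add: replicate_mset_add)
    then have P: "has_perfect (replicate_mset (?k + (x - 1)) 1 + replicate_mset (i * x + 2) x)"
      using has_perfect_add[OF has_perfect_ones has_perfect_x_copies_2, of ?k i]
      by (metis add.assoc)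
    show ?thesis
      by (rule exI[of _ "?k + (x - 1)"], rule exI[of _ "i * x + 2"]) (use P 3 r x in auto)
  qed
qed

section \<open>Orders of \<open>n\<close> residues with a prescribed cut, by steps 1 and
  \<open>x\<close>\<close>

lemma even_mod_pred:
  assumes "odd (m mod x)"
  shows "even ((m - 1) mod x)"
proof -
  have "m mod x > 0"
    using assms by (auto elim: oddE)
  then have "(m - 1) mod x = m mod x - 1"
    using x mod_Suc[of "m - 1" x] by (cases m) (auto split: if_splits)
  then show ?thesis
    using assms by simp
qed

text \<open>After \<open>t\<close> ones there remain \<open>n - t\<close> vertices, filled by a lift
  with \<open>x - 1\<close> ones; the padding \<open>t\<close> serves to adjust the remainder modulo
  \<open>x\<close>.\<close>

lemma has_standard_pad:
  assumes "even ((n - t) mod x) \<or> (n - t) mod x = 1" "t + x \<le> n"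
  shows "has_standard (replicate_mset (t + (x - 1)) 1 + replicate_mset (n - t - x) x)"
proof -
  have "(n - t) mod x = (n - t - x) mod x"
    using assms(2) x by (simp add: le_mod_geq)
  then have "has_standard (replicate_mset (x - 1) 1 + replicate_mset (n - t - x) x)"
    using assms(1) has_standard_x_copies by simp
  then show ?thesis
    using has_standard_add[OF has_perfect_ones, of _ t] by (simp add: replicate_mset_add add.assoc)
qed

text \<open>The lower bound \<open>2 * x - 2\<close> on the ones limits the copies of
  \<open>x\<close> used up here, and the upper bound \<open>3 * x - 4\<close> leaves enough ones for
  the other part of the final path.\<close>

lemma column_order_exists:
  assumes n: "2 * x \<le> n + 2" and r: "r < n"
  shows "\<exists>M N. has_perfect M \<and> size M = r \<and> has_standard N \<and> Suc (size (M + N)) = n \<and>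
    (\<exists>a b. M + N = replicate_mset a 1 + replicate_mset b x \<and> a + 4 \<le> 3 * x \<and>
      (2 * x \<le> a + 2 \<or> b = 0))"
proof -
  have goal: ?thesis
    if "has_perfect (replicate_mset u 1 + replicate_mset b x)" "u + b = r"
      "has_standard (replicate_mset v 1 + replicate_mset c x)" "Suc (u + b + (v + c)) = n"
      "u + v + 4 \<le> 3 * x" "2 * x \<le> u + v + 2 \<or> b + c = 0" for u v b c
  proof -
    let ?M = "replicate_mset u 1 + replicate_mset b x" and ?N = "replicate_mset v 1 + replicate_mset c x"
    have "?M + ?N = replicate_mset (u + v) 1 + replicate_mset (b + c) x"
      by (simp only: replicate_mset_add ac_simps)
    moreover have "size ?M = r" "Suc (size (?M + ?N)) = n"
      using that(2,4) by simp_all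
    ultimately show ?thesis
      using that(1,3,5,6) by blast
  qed
  have ones: "has_perfect (replicate_mset u 1 + replicate_mset 0 x)"
    "has_standard (replicate_mset u 1 + replicate_mset 0 x)" for u
    using has_perfect_ones has_perfect_imp_has_standard by simp_all
  \<comment> \<open>Only ones suffice if \<open>n\<close> is small. Otherwise copies of
    \<open>x\<close> are put behind the cut, on both sides of it, or before it, according to which
    sides are long enough.\<close>
  consider (small) "n + 3 \<le> 3 * x" | (left) "3 * x < n + 3" "r + 4 \<le> 2 * x"
    | (both) "3 * x < n + 3" "2 * x \<le> r + 3" "x \<le> n - r"
    | (right) "3 * x < n + 3" "2 * x \<le> r + 3" "n - r < x"
    by linarith
  then show ?thesis
  proof cases
    case small
    then show ?thesis
      using r by (intro goal[OF ones(1) _ ones(2), of r "n - 1 - r"]) auto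
  next
    case left
    define t0 where "t0 = max r (x - 1)"
    \<comment> \<open>One further one turns an odd remainder into an even one. As \<open>t\<close>
      lies between \<open>x - 1\<close> and \<open>2 * x - 3\<close>, the total
      \<open>t + (x - 1)\<close> stays within the bounds.\<close>
    define t where "t = (if even ((n - t0) mod x) then t0 else Suc t0)"
    have ev: "even ((n - t) mod x)"
      using even_mod_pred[of "n - t0"] by (simp add: t_def)
    have t: "r \<le> t" "x \<le> t + 1" "t + 3 \<le> 2 * x"
      using left x_ge_3 by (auto simp: t_def t0_def)
    define e s where "e = n - r" and "s = t - r"
    have es: "n = r + e" "t = r + s"
      using r t(1) by (simp_all add: e_def s_def)
    then have "even ((e - s) mod x)"
      using ev by simp
    moreover have "s + x \<le> e"
      using left t x_ge_3 es by linarith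
    ultimately have "has_standard (replicate_mset (s + (x - 1)) 1 + replicate_mset (e - s - x) x)"
      using has_standard_pad by blast
    then show ?thesis
    proof (rule goal[OF ones(1), rotated])
      show "Suc (r + 0 + (s + (x - 1) + (e - s - x))) = n"
        using \<open>s + x \<le> e\<close> es x_ge_3 by linarith
      show "r + (s + (x - 1)) + 4 \<le> 3 * x" "2 * x \<le> r + (s + (x - 1)) + 2 \<or> 0 + (e - s - x) = 0"
        using t es x_ge_3 by linarith+
    qed simp
  next
    case both
    have "x \<le> r"
      using both x_ge_3 by simp
    then obtain u b where u: "has_perfect (replicate_mset u 1 + replicate_mset b x)" "u + b = r"
        "x \<le> u + 1" "u + 4 \<le> 2 * x \<or> u \<le> x"
      using has_perfect_ones_x_copies by blast
    define e where "e = n - r"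
    have e: "x \<le> e" "n = r + e"
      using both r by (simp_all add: e_def)
    show ?thesis
    proof (cases "even (e mod x) \<or> e mod x = 1")
      case True
      then have "has_standard (replicate_mset (0 + (x - 1)) 1 + replicate_mset (e - 0 - x) x)"
        using e by (intro has_standard_pad) auto
      then show ?thesis
        using e u x_ge_3 by (intro goal[OF u(1,2)]) auto
    next
      case False
      have "e mod x < x"
        using x by simp
      moreover have "e mod x \<noteq> 0" "e mod x \<noteq> 1" "e mod x \<noteq> 2"
        using False odd_pos[of "e mod x"] by auto
      \<comment> \<open>The remainder is odd and at least 3. The extra padding one then fits: even
        for \<open>u = x\<close> the total \<open>2 * x\<close> is at most
        \<open>3 * x - 4\<close>.\<close>
      ultimately have "x > 3"
        by linarith
      have "e \<noteq> x"
        using False x by auto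
      then have "has_standard (replicate_mset (1 + (x - 1)) 1 + replicate_mset (e - 1 - x) x)"
        using e False even_mod_pred by (intro has_standard_pad) auto
      then show ?thesis
        using e u \<open>x > 3\<close> \<open>e \<noteq> x\<close> by (intro goal[OF u(1,2)]) auto
    qed
  next
    case right
    define e where "e = n - r"
    have e: "0 < e" "e < x" "n = r + e"
      using right r by (simp_all add: e_def)
    \<comment> \<open>The \<open>e - 1\<close> ones behind the cut and \<open>x - e + 1\<close>
      edges before it make \<open>x\<close>; \<open>w\<close> edges remain. If
      \<open>m = x - 1\<close>, there are \<open>2 * x - 1\<close> ones in total, otherwise
      \<open>2 * x - 2 + m\<close> with \<open>m \<le> x - 2\<close>.\<close>
    define w where "w = r - (x - e) - 1"
    define m j where "m = w mod x" and "j = w div x"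
    have w: "r = (x - e) + 1 + w" "x \<le> w"
      using right e x_ge_3 by (simp_all add: w_def)
    have wm: "w = j * x + m" "m < x"
      using x by (simp_all add: m_def j_def)
    show ?thesis
    proof (cases "m = x - 1")
      case True
      have "has_perfect (replicate_mset (x + 1 - e) 1 + (replicate_mset (x - 1) 1 + replicate_mset (j * x) x))"
        by (intro has_perfect_add has_perfect_ones has_perfect_x_copies)
      then have P: "has_perfect (replicate_mset (x + 1 - e + (x - 1)) 1 + replicate_mset (j * x) x)"
        by (simp only: replicate_mset_add add.assoc)
      show ?thesis
        by (rule goal[OF P _ ones(2)[of "e - 1"]]) (use True e w wm x_ge_3 in auto)
    next
      case False
      have "j > 0"
        using w x by (simp add: j_def div_greater_zero_iff)
      then obtain i where i: "j = Suc i"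
        by (cases j) auto
      have "has_perfect (replicate_mset (x - e + m) 1 + (replicate_mset (x - 1) 1 + replicate_mset (i * x + 2) x))"
        by (intro has_perfect_add has_perfect_ones has_perfect_x_copies_2)
      then have P: "has_perfect (replicate_mset (x - e + m + (x - 1)) 1 + replicate_mset (i * x + 2) x)"
        by (simp only: replicate_mset_add add.assoc)
      show ?thesis
        by (rule goal[OF P _ ones(2)[of "e - 1"]]) (use False e w wm i x_ge_3 in auto)
    qed
  qed
qed

end

section \<open>Two standard realizations put together for the lengths 1, \<open>x\<close> and
  \<open>y\<close>\<close>

theorem theorem3p4:
  fixes x y a b c :: nat
  assumes "odd x" and "x > 1"
    and "int y > 2 * int x - 2"
    and "int a \<ge> 4 * int x - 3"
    and "int b \<ge> int y - 2 * int x + 2"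
  shows "has_linear_realization
           (replicate_mset a 1 + replicate_mset b x + replicate_mset c y)"
proof -
  have y: "2 * x \<le> y + 1" and a: "4 * x \<le> a + 3" and b: "y + 2 \<le> b + 2 * x"
    using assms by linarith+
  define K where "K n M \<longleftrightarrow> (\<exists>i j. M = replicate_mset i 1 + replicate_mset j x \<and> Suc (i + j) = n \<and>
    i + 4 \<le> 3 * x \<and> (2 * x \<le> i + 2 \<or> j = 0))" for n M
  have "\<exists>M. has_standard (M + replicate_mset c y) \<and>
    (K y M \<or> (\<exists>N. K (y - 1) N \<and> M = add_mset 1 N) \<or> (\<exists>N l. K y N \<and> l \<in># N \<and> M = add_mset l N))"
  proof (rule has_standard_with_copies)
    show "y > 1"
      using y assms by linarith
    fix n r assume "n = y - 1 \<or> n = y" "r < n"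
    then have "2 * x \<le> n + 2" "r < n"
      using y by auto
    from column_order_exists[OF assms(1,2) this] obtain M N i j where *: "has_perfect M" "size M = r"
      "has_standard N" "Suc (size (M + N)) = n" "M + N = replicate_mset i 1 + replicate_mset j x"
      "i + 4 \<le> 3 * x" "2 * x \<le> i + 2 \<or> j = 0"
      by blast
    moreover have "Suc (i + j) = n"
      using *(4) unfolding *(5) by simp
    ultimately show "\<exists>M N. has_perfect M \<and> size M = r \<and> has_standard N \<and> Suc (size (M + N)) = n \<and> K n (M + N)"
      unfolding K_def by blast
  qed
  then obtain M where M: "has_standard (M + replicate_mset c y)"
    and MK: "K y M \<or> (\<exists>N. K (y - 1) N \<and> M = add_mset 1 N) \<or> (\<exists>N l. K y N \<and> l \<in># N \<and> M = add_mset l N)"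
    by blast
  \<comment> \<open>A bridge or a rotation may add a one, so up to \<open>3 * x - 3\<close> occur.
    Unless only ones are used, at least \<open>2 * x - 2\<close> of the \<open>y - 1\<close> steps
    are ones, so at most \<open>y - 2 * x + 1\<close> are copies of \<open>x\<close>; a rotation may
    add one more, which matches the bound on \<open>b\<close>.\<close>
  have "\<exists>i j. M = replicate_mset i 1 + replicate_mset j x \<and> i + 3 \<le> 3 * x \<and> j \<le> b"
    using MK
  proof (elim disjE exE conjE)
    assume "K y M"
    then show ?thesis
      using b y unfolding K_def by fastforce
  next
    fix N assume "K (y - 1) N" and M: "M = add_mset 1 N"
    then obtain i j where N: "N = replicate_mset i 1 + replicate_mset j x" "Suc (i + j) = y - 1"
      "i + 4 \<le> 3 * x" "2 * x \<le> i + 2 \<or> j = 0"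
      unfolding K_def by blast
    show ?thesis
      by (rule exI[of _ "Suc i"], rule exI[of _ j]) (use b y M N in auto)
  next
    fix N l assume "K y N" and l: "l \<in># N" and M: "M = add_mset l N"
    then obtain i j where N: "N = replicate_mset i 1 + replicate_mset j x" "Suc (i + j) = y"
      "i + 4 \<le> 3 * x" "2 * x \<le> i + 2 \<or> j = 0"
      unfolding K_def by blast
    have "l = 1 \<or> l = x"
      using l N(1) by (auto split: if_splits)
    then show ?thesis
    proof
      assume l1: "l = 1"
      show ?thesis
        by (rule exI[of _ "Suc i"], rule exI[of _ j]) (use l1 b y M N in auto)
    next
      assume lx: "l = x"
      show ?thesis
        by (rule exI[of _ i], rule exI[of _ "Suc j"]) (use lx b y M N in auto)
    qed
  qed
  then obtain i j where ij: "M = replicate_mset i 1 + replicate_mset j x" "i + 3 \<le> 3 * x" "j \<le> b"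
    by blast
  \<comment> \<open>From \<open>a \<ge> 4 * x - 3\<close> and \<open>i \<le> 3 * x - 3\<close>, at
    least \<open>x\<close> ones are left over for the other part of the path.\<close>
  have "has_standard (replicate_mset (a - i) 1 + replicate_mset (b - j) x)"
    using ij a assms by (intro has_standard_ones_x_copies) auto
  from has_standard_add_realizes[OF this M] obtain p where
    p: "realizes p (replicate_mset (a - i) 1 + replicate_mset (b - j) x + (M + replicate_mset c y))"
    by blast
  have "replicate_mset a 1 = replicate_mset (a - i) 1 + replicate_mset i (1 :: nat)"
    "replicate_mset b x = replicate_mset (b - j) x + replicate_mset j x"
    using ij a by (simp_all flip: replicate_mset_add)
  then have "replicate_mset (a - i) 1 + replicate_mset (b - j) x + (M + replicate_mset c y) =
      replicate_mset a 1 + replicate_mset b x + replicate_mset c y"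
    by (simp only: ij(1) ac_simps)
  then show ?thesis
    using realizes_imp_has_linear_realization[OF p] by (simp only:)
qed

end
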